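(* Let $\mathfrak{C}=\langle\mathsf{C},\preceq\rangle$ be a classical case model all of whose formulas are built using only $\neg,\wedge,\vee$, and let $\mathfrak{C}_{\mathsf{BD}\triangle}=\langle\mathsf{C}_{\mathsf{BD}\triangle},\preceq_{\mathsf{BD}\triangle}\rangle$ be its $\mathsf{BD}\triangle$ counterpart. Then: (1) $\mathfrak{C}_{\mathsf{BD}\triangle}$ is a quasi-classical $\mathsf{BD}\triangle$ case model; (2) for all formulas $\phi,\chi$ built from variables using only $\neg,\wedge,\vee$, the argument $\langle\phi,\chi\rangle$ is classically coherent (resp. classically presumptively valid, classically conclusive) over $\mathfrak{C}$ iff $\langle\phi^\mathbf{t},\chi^\mathbf{t}\rangle$ is strongly coherent (resp. strongly presumptively valid, strongly conclusive) over $\mathfrak{C}_{\mathsf{BD}\triangle}$.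
   Context: Classical side: $\models_{\mathsf{CPL}}$ is classical propositional entailment. A classical case model is $\langle\mathsf{C},\preceq\rangle$ with $\mathsf{C}$ a finite set of classically satisfiable formulas such that any two distinct elements have classically unsatisfiable conjunction, and $\preceq$ a total preorder on $\mathsf{C}$. An argument $\langle\phi,\chi\rangle$ is classically coherent iff some $\psi\in\mathsf{C}$ has $\psi\models_{\mathsf{CPL}}\phi\wedge\chi$; classically conclusive iff it is classically coherent and every $\psi\in\mathsf{C}$ with $\psi\models_{\mathsf{CPL}}\phi$ has $\psi\models_{\mathsf{CPL}}\phi\wedge\chi$; classically presumptively valid iff there is $\psi\in\mathsf{C}$ with $\psi\models_{\mathsf{CPL}}\phi\wedge\chi$ and $\psi\succeq\psi'$ for every $\psi'\in\mathsf{C}$ with $\psi'\models_{\mathsf{CPL}}\phi$. $\mathsf{BD}\triangle$ side: $\mathscr{L}_{\mathsf{BD}\triangle}$ consists of formulas built from a countable set $\mathtt{Prop}$ of variables by $\neg,\wedge,\vee,\triangle$. A $\mathsf{BD}\triangle$ model is $\langle W,v^+,v^-\rangle$ with $v^+,v^-:\mathtt{Prop}\to2^W$; at $w\in W$: $w\vDash^\pm p$ iff $w\in v^\pm(p)$; $w\vDash^+\neg\phi$ iff $w\vDash^-\phi$, $w\vDash^-\neg\phi$ iff $w\vDash^+\phi$; $w\vDash^+\phi\wedge\phi'$ iff both $w\vDash^+\phi,w\vDash^+\phi'$, $w\vDash^-\phi\wedge\phi'$ iff $w\vDash^-\phi$ or $w\vDash^-\phi'$; $w\vDash^+\phi\vee\phi'$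 iff $w\vDash^+\phi$ or $w\vDash^+\phi'$, $w\vDash^-\phi\vee\phi'$ iff both $w\vDash^-\phi,w\vDash^-\phi'$; $w\vDash^+\triangle\phi$ iff $w\vDash^+\phi$, $w\vDash^-\triangle\phi$ iff $w\nvDash^+\phi$. With $|\phi|^\pm=\{w:w\vDash^\pm\phi\}$, $\phi\models_{\mathsf{BD}\triangle}\chi$ iff in every model $|\phi|^+\subseteq|\chi|^+$ and $|\chi|^-\subseteq|\phi|^-$. Abbreviations: $\mathbf{t}(\phi)=\triangle\phi\wedge\neg\triangle\neg\phi$; $\top=\triangle p\vee\neg\triangle p$ for a fixed variable $p$; $\bot=\neg\top$. A $\mathsf{BD}\triangle$ case model is $\langle\mathsf{C},\preceq\rangle$ with $\mathsf{C}$ a finite set of formulas with $\psi\not\models_{\mathsf{BD}\triangle}\bot$ for all $\psi\in\mathsf{C}$ and $\psi\wedge\psi'\models_{\mathsf{BD}\triangle}\bot$ for distinct $\psi,\psi'\in\mathsf{C}$, and $\preceq$ a total preorder; it is quasi-classical iff every element of $\mathsf{C}$ is built from formulas $\mathbf{t}(p)$ using only $\neg,\wedge,\vee$. An argument $\langle\phi,\chi\rangle$ is strongly coherent iff some $\psi\in\mathsf{C}$ has $\psi\models_{\mathsf{BD}\triangle}\phi\wedge\mathbf{t}(\chi)$; strongly conclusive iff it is strongly coherent and every $\psi\in\mathsf{C}$ with $\psi\models_{\mathsf{BD}\triangle}\phi$ has $\psi\models_{\mathsf{BD}\triangle}\phi\wedge\mathbf{t}(\chi)$; strongly presumptively valid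 iff some $\psi\in\mathsf{C}$ has $\psi\models_{\mathsf{BD}\triangle}\phi\wedge\mathbf{t}(\chi)$ and $\psi\succeq\psi'$ for all $\psi'\in\mathsf{C}$ with $\psi'\models_{\mathsf{BD}\triangle}\phi$. Translation: for a formula $\phi$ over $\neg,\wedge,\vee$, $\phi^\mathbf{t}$ is obtained by replacing every variable $p$ in $\phi$ by $\mathbf{t}(p)$. The $\mathsf{BD}\triangle$ counterpart of $\mathfrak{C}$ is $\langle\{\chi^\mathbf{t}:\chi\in\mathsf{C}\},\preceq_{\mathsf{BD}\triangle}\rangle$ with $\chi^\mathbf{t}\preceq_{\mathsf{BD}\triangle}{\chi'}^\mathbf{t}$ iff $\chi\preceq\chi'$. *)

theory Defs
  imports Main "HOL-Library.Countable"
begin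

datatype 'p cfm =
    CVar 'p
  | CNeg "'p cfm"
  | CConj "'p cfm" "'p cfm"
  | CDisj "'p cfm" "'p cfm"

primrec csat :: "('p \<Rightarrow> bool) \<Rightarrow> 'p cfm \<Rightarrow> bool" where
  "csat v (CVar p) \<longleftrightarrow> v p"
| "csat v (CNeg \<phi>) \<longleftrightarrow> \<not> csat v \<phi>"
| "csat v (CConj \<phi> \<chi>) \<longleftrightarrow> csat v \<phi> \<and> csat v \<chi>"
| "csat v (CDisj \<phi> \<chi>) \<longleftrightarrow> csat v \<phi> \<or> csat v \<chi>"

definition cpl_satisfiable :: "'p cfm \<Rightarrow> bool" where
  "cpl_satisfiable \<phi> \<longleftrightarrow> (\<exists>v. csat v \<phi>)"

definition cpl_entails :: "'p cfm \<Rightarrow> 'p cfm \<Rightarrow> bool" where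
  "cpl_entails \<phi> \<chi> \<longleftrightarrow> (\<forall>v. csat v \<phi> \<longrightarrow> csat v \<chi>)"

datatype 'p bdfm =
    Var 'p
  | Neg "'p bdfm"
  | Conj "'p bdfm" "'p bdfm"
  | Disj "'p bdfm" "'p bdfm"
  | Tri "'p bdfm"

record ('p, 'w) bd_model =
  worlds :: "'w set"
  vpos :: "'p \<Rightarrow> 'w set"
  vneg :: "'p \<Rightarrow> 'w set"

definition is_bd_model :: "('p, 'w) bd_model \<Rightarrow> bool" where
  "is_bd_model M \<longleftrightarrow> (\<forall>p. vpos M p \<subseteq> worlds M \<and> vneg M p \<subseteq> worlds M)"

fun verifies :: "('p, 'w) bd_model \<Rightarrow> 'w \<Rightarrow> 'p bdfm \<Rightarrow> bool"
  and falsifies :: "('p, 'w) bd_model \<Rightarrow> 'w \<Rightarrow> 'p bdfm \<Rightarrow> bool" where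
  "verifies M w (Var p) \<longleftrightarrow> w \<in> vpos M p"
| "verifies M w (Neg \<phi>) \<longleftrightarrow> falsifies M w \<phi>"
| "verifies M w (Conj \<phi> \<chi>) \<longleftrightarrow> verifies M w \<phi> \<and> verifies M w \<chi>"
| "verifies M w (Disj \<phi> \<chi>) \<longleftrightarrow> verifies M w \<phi> \<or> verifies M w \<chi>"
| "verifies M w (Tri \<phi>) \<longleftrightarrow> verifies M w \<phi>"
| "falsifies M w (Var p) \<longleftrightarrow> w \<in> vneg M p"
| "falsifies M w (Neg \<phi>) \<longleftrightarrow> verifies M w \<phi>"
| "falsifies M w (Conj \<phi> \<chi>) \<longleftrightarrow> falsifies M w \<phi> \<or> falsifies M w \<chi>"
| "falsifies M w (Disj \<phi> \<chi>) \<longleftrightarrow> falsifies M w \<phi> \<and> falsifies M w \<chi>"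
| "falsifies M w (Tri \<phi>) \<longleftrightarrow> \<not> verifies M w \<phi>"

definition pos_ext :: "('p, 'w) bd_model \<Rightarrow> 'p bdfm \<Rightarrow> 'w set" where
  "pos_ext M \<phi> = {w \<in> worlds M. verifies M w \<phi>}"

definition neg_ext :: "('p, 'w) bd_model \<Rightarrow> 'p bdfm \<Rightarrow> 'w set" where
  "neg_ext M \<phi> = {w \<in> worlds M. falsifies M w \<phi>}"

text \<open>A definition cannot quantify over all types of worlds, so entailment ranges over the
  models whose worlds are natural numbers.  The lemma \<open>bd_entails_any_model\<close> below shows that
  this covers the models over every type of worlds.\<close>

definition bd_entails :: "'p bdfm \<Rightarrow> 'p bdfm \<Rightarrow> bool" where
  "bd_entails \<phi> \<chi> \<longleftrightarrow>
     (\<forall>M :: ('p, nat) bd_model. is_bd_model M \<longrightarrow>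
        pos_ext M \<phi> \<subseteq> pos_ext M \<chi> \<and> neg_ext M \<chi> \<subseteq> neg_ext M \<phi>)"

lemma verifies_falsifies_cong:
  assumes "\<And>p. w \<in> vpos M p \<longleftrightarrow> w' \<in> vpos M' p"
    and "\<And>p. w \<in> vneg M p \<longleftrightarrow> w' \<in> vneg M' p"
  shows "(verifies M w \<phi> \<longleftrightarrow> verifies M' w' \<phi>) \<and> (falsifies M w \<phi> \<longleftrightarrow> falsifies M' w' \<phi>)"
  by (induction \<phi>) (auto simp: assms)

lemma bd_entails_any_model:
  fixes M :: "('p, 'w) bd_model"
  assumes ent: "bd_entails \<phi> \<chi>" and M: "is_bd_model M"
  shows "pos_ext M \<phi> \<subseteq> pos_ext M \<chi> \<and> neg_ext M \<chi> \<subseteq> neg_ext M \<phi>"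
proof -
  have "(verifies M w \<phi> \<longrightarrow> verifies M w \<chi>) \<and> (falsifies M w \<chi> \<longrightarrow> falsifies M w \<phi>)" for w
  proof -
    define N :: "('p, nat) bd_model" where
      "N = \<lparr>worlds = {0}, vpos = (\<lambda>p. if w \<in> vpos M p then {0} else {}),
            vneg = (\<lambda>p. if w \<in> vneg M p then {0} else {})\<rparr>"
    have eq: "(verifies M w \<psi> \<longleftrightarrow> verifies N 0 \<psi>) \<and> (falsifies M w \<psi> \<longleftrightarrow> falsifies N 0 \<psi>)" for \<psi>
      by (rule verifies_falsifies_cong) (auto simp: N_def)
    have "is_bd_model N" by (auto simp: is_bd_model_def N_def)
    with ent have "pos_ext N \<phi> \<subseteq> pos_ext N \<chi> \<and> neg_ext N \<chi> \<subseteq> neg_ext N \<phi>"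
      by (auto simp: bd_entails_def)
    moreover have "worlds N = {0}" by (simp add: N_def)
    ultimately show ?thesis by (auto simp: pos_ext_def neg_ext_def eq)
  qed
  then show ?thesis by (auto simp: pos_ext_def neg_ext_def)
qed

definition tt :: "'p bdfm \<Rightarrow> 'p bdfm" where
  "tt \<phi> = Conj (Tri \<phi>) (Neg (Tri (Neg \<phi>)))"

text \<open>The variable that is fixed in the definition of the constants top and bottom is an
  explicit parameter.\<close>

definition bd_top :: "'p \<Rightarrow> 'p bdfm" where
  "bd_top q = Disj (Tri (Var q)) (Neg (Tri (Var q)))"

definition bd_bot :: "'p \<Rightarrow> 'p bdfm" where
  "bd_bot q = Neg (bd_top q)"

text \<open>A pair \<open>(C, r)\<close>, where \<open>(\<psi>, \<psi>') \<in> r\<close> stands for \<open>\<psi> \<preceq> \<psi>'\<close>.\<close>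

type_synonym 'f cases = "'f set \<times> 'f rel"

definition total_preorder_on :: "'f set \<Rightarrow> 'f rel \<Rightarrow> bool" where
  "total_preorder_on C r \<longleftrightarrow> preorder_on C r \<and> total_on C r"

fun classical_case_model :: "'p cfm cases \<Rightarrow> bool" where
  "classical_case_model (C, r) \<longleftrightarrow>
     finite C \<and>
     (\<forall>\<psi>\<in>C. cpl_satisfiable \<psi>) \<and>
     (\<forall>\<psi>\<in>C. \<forall>\<psi>'\<in>C. \<psi> \<noteq> \<psi>' \<longrightarrow> \<not> cpl_satisfiable (CConj \<psi> \<psi>')) \<and>
     total_preorder_on C r"

fun classically_coherent :: "'p cfm cases \<Rightarrow> 'p cfm \<Rightarrow> 'p cfm \<Rightarrow> bool" where
  "classically_coherent (C, r) \<phi> \<chi> \<longleftrightarrow> (\<exists>\<psi>\<in>C. cpl_entails \<psi> (CConj \<phi> \<chi>))"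

fun classically_conclusive :: "'p cfm cases \<Rightarrow> 'p cfm \<Rightarrow> 'p cfm \<Rightarrow> bool" where
  "classically_conclusive (C, r) \<phi> \<chi> \<longleftrightarrow>
     classically_coherent (C, r) \<phi> \<chi> \<and>
     (\<forall>\<psi>\<in>C. cpl_entails \<psi> \<phi> \<longrightarrow> cpl_entails \<psi> (CConj \<phi> \<chi>))"

fun classically_presumptively_valid :: "'p cfm cases \<Rightarrow> 'p cfm \<Rightarrow> 'p cfm \<Rightarrow> bool" where
  "classically_presumptively_valid (C, r) \<phi> \<chi> \<longleftrightarrow>
     (\<exists>\<psi>\<in>C. cpl_entails \<psi> (CConj \<phi> \<chi>) \<and>
        (\<forall>\<psi>'\<in>C. cpl_entails \<psi>' \<phi> \<longrightarrow> (\<psi>', \<psi>) \<in> r))"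

fun bd_case_model :: "'p \<Rightarrow> 'p bdfm cases \<Rightarrow> bool" where
  "bd_case_model q (C, r) \<longleftrightarrow>
     finite C \<and>
     (\<forall>\<psi>\<in>C. \<not> bd_entails \<psi> (bd_bot q)) \<and>
     (\<forall>\<psi>\<in>C. \<forall>\<psi>'\<in>C. \<psi> \<noteq> \<psi>' \<longrightarrow> bd_entails (Conj \<psi> \<psi>') (bd_bot q)) \<and>
     total_preorder_on C r"

inductive quasi_classical_fm :: "'p bdfm \<Rightarrow> bool" where
  "quasi_classical_fm (tt (Var p))"
| "quasi_classical_fm \<phi> \<Longrightarrow> quasi_classical_fm (Neg \<phi>)"
| "quasi_classical_fm \<phi> \<Longrightarrow> quasi_classical_fm \<chi> \<Longrightarrow> quasi_classical_fm (Conj \<phi> \<chi>)"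
| "quasi_classical_fm \<phi> \<Longrightarrow> quasi_classical_fm \<chi> \<Longrightarrow> quasi_classical_fm (Disj \<phi> \<chi>)"

fun quasi_classical_case_model :: "'p \<Rightarrow> 'p bdfm cases \<Rightarrow> bool" where
  "quasi_classical_case_model q (C, r) \<longleftrightarrow>
     bd_case_model q (C, r) \<and> (\<forall>\<psi>\<in>C. quasi_classical_fm \<psi>)"

fun strongly_coherent :: "'p bdfm cases \<Rightarrow> 'p bdfm \<Rightarrow> 'p bdfm \<Rightarrow> bool" where
  "strongly_coherent (C, r) \<phi> \<chi> \<longleftrightarrow> (\<exists>\<psi>\<in>C. bd_entails \<psi> (Conj \<phi> (tt \<chi>)))"

fun strongly_conclusive :: "'p bdfm cases \<Rightarrow> 'p bdfm \<Rightarrow> 'p bdfm \<Rightarrow> bool" where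
  "strongly_conclusive (C, r) \<phi> \<chi> \<longleftrightarrow>
     strongly_coherent (C, r) \<phi> \<chi> \<and>
     (\<forall>\<psi>\<in>C. bd_entails \<psi> \<phi> \<longrightarrow> bd_entails \<psi> (Conj \<phi> (tt \<chi>)))"

fun strongly_presumptively_valid :: "'p bdfm cases \<Rightarrow> 'p bdfm \<Rightarrow> 'p bdfm \<Rightarrow> bool" where
  "strongly_presumptively_valid (C, r) \<phi> \<chi> \<longleftrightarrow>
     (\<exists>\<psi>\<in>C. bd_entails \<psi> (Conj \<phi> (tt \<chi>)) \<and>
        (\<forall>\<psi>'\<in>C. bd_entails \<psi>' \<phi> \<longrightarrow> (\<psi>', \<psi>) \<in> r))"

primrec tr :: "'p cfm \<Rightarrow> 'p bdfm" where
  "tr (CVar p) = tt (Var p)"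
| "tr (CNeg \<phi>) = Neg (tr \<phi>)"
| "tr (CConj \<phi> \<chi>) = Conj (tr \<phi>) (tr \<chi>)"
| "tr (CDisj \<phi> \<chi>) = Disj (tr \<phi>) (tr \<chi>)"

fun bd_counterpart :: "'p cfm cases \<Rightarrow> 'p bdfm cases" where
  "bd_counterpart (C, r) = (tr ` C, {(tr \<chi>, tr \<chi>') | \<chi> \<chi>'. (\<chi>, \<chi>') \<in> r})"

text \<open>Because the translation is injective, the order of the counterpart satisfies the
  intended equivalence, not only one direction of it.\<close>

lemma tr_ne_Tri: "tr \<phi> \<noteq> Tri \<psi>"
  by (cases \<phi>) (auto simp: tt_def)

lemma tr_eq_iff: "tr \<phi> = tr \<phi>' \<longleftrightarrow> \<phi> = \<phi>'"
proof (induction \<phi> arbitrary: \<phi>')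
  case (CVar p) then show ?case
    by (cases \<phi>') (auto simp: tt_def tr_ne_Tri tr_ne_Tri[symmetric])
next
  case (CNeg \<phi>) then show ?case by (cases \<phi>') (auto simp: tt_def)
next
  case (CConj \<phi> \<chi>) then show ?case by (cases \<phi>') (auto simp: tt_def tr_ne_Tri)
next
  case (CDisj \<phi> \<chi>) then show ?case by (cases \<phi>') (auto simp: tt_def)
qed

lemma bd_counterpart_order_iff:
  "(tr \<chi>, tr \<chi>') \<in> snd (bd_counterpart (C, r)) \<longleftrightarrow> (\<chi>, \<chi>') \<in> r"
  by (auto simp: tr_eq_iff)

end

(* At every world w, each variable p gives a classical valuation: p holds at w iff w verifies but
   does not falsify p, that is, iff w verifies t(p).  Since t(p) is never glutty or gappy, neither
   is the translation of any formula, so it is evaluated classically at w; conversely, every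
   classical valuation arises from a one-world model.  Hence entailment between formulas that
   behave like translations, such as bottom and the conjunctions with t(_) in the strong notions,
   is classical entailment. *)

theory Submission
  imports Defs
begin

definition classical_val :: "('p, 'w) bd_model \<Rightarrow> 'w \<Rightarrow> 'p \<Rightarrow> bool" where
  "classical_val M w p \<longleftrightarrow> w \<in> vpos M p \<and> w \<notin> vneg M p"

text \<open>The second clause makes falsification the complement of verification, which excludes
  gluts and gaps.\<close>

definition reads_as :: "'p bdfm \<Rightarrow> 'p cfm \<Rightarrow> bool" where
  "reads_as \<xi> \<psi> \<longleftrightarrow>
     (\<forall>(M :: ('p, nat) bd_model) w. verifies M w \<xi> = csat (classical_val M w) \<psi> \<and>
        falsifies M w \<xi> = (\<not> csat (classical_val M w) \<psi>))"

lemma reads_as_tr: "reads_as (tr \<psi>) \<psi>"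
  by (induction \<psi>) (auto simp: reads_as_def tt_def classical_val_def)

lemma reads_as_Conj:
  assumes "reads_as \<xi> \<psi>" "reads_as \<xi>' \<psi>'"
  shows "reads_as (Conj \<xi> \<xi>') (CConj \<psi> \<psi>')"
  using assms by (simp add: reads_as_def)

text \<open>\<open>tt\<close> turns gluts and gaps into plain falsity and keeps the two classical
  values, so it changes nothing here.\<close>

lemma reads_as_tt:
  assumes "reads_as \<xi> \<psi>"
  shows "reads_as (tt \<xi>) \<psi>"
  using assms by (simp add: reads_as_def tt_def)

text \<open>Reading bottom as a contradiction makes it an instance of the general entailment
  lemma.\<close>

lemma reads_as_bd_bot: "reads_as (bd_bot q) (CConj (CVar q) (CNeg (CVar q)))"
  by (simp add: reads_as_def bd_bot_def bd_top_def)

lemma bd_entails_iff_cpl_entails: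
  assumes "reads_as \<xi> \<psi>" "reads_as \<xi>' \<psi>'"
  shows "bd_entails \<xi> \<xi>' \<longleftrightarrow> cpl_entails \<psi> \<psi>'"
proof
  assume "cpl_entails \<psi> \<psi>'"
  \<comment> \<open>The inclusion of negative extensions is the contrapositive of the one for
    positive extensions.\<close>
  then show "bd_entails \<xi> \<xi>'"
    using assms by (auto simp: bd_entails_def cpl_entails_def reads_as_def pos_ext_def neg_ext_def)
next
  assume ent: "bd_entails \<xi> \<xi>'"
  show "cpl_entails \<psi> \<psi>'"
    unfolding cpl_entails_def
  proof (intro allI impI)
    fix v assume v: "csat v \<psi>"
    \<comment> \<open>A variable false under \<open>v\<close> becomes a gap, which
      \<open>classical_val\<close> counts as false.\<close>
    define M :: "('a, nat) bd_model" where
      "M = \<lparr>worlds = {0}, vpos = (\<lambda>p. if v p then {0} else {}), vneg = (\<lambda>p. {})\<rparr>"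
    have val: "classical_val M 0 = v"
      by (auto simp: fun_eq_iff classical_val_def M_def)
    have "is_bd_model M" "0 \<in> worlds M"
      by (auto simp: is_bd_model_def M_def)
    moreover have "verifies M 0 \<xi>"
      using assms(1) v val by (simp add: reads_as_def)
    ultimately have "verifies M 0 \<xi>'"
      using ent by (auto simp: bd_entails_def pos_ext_def)
    then show "csat v \<psi>'"
      using assms(2) val by (simp add: reads_as_def)
  qed
qed

lemma bd_entails_bd_bot_iff:
  assumes "reads_as \<xi> \<psi>"
  shows "bd_entails \<xi> (bd_bot q) \<longleftrightarrow> \<not> cpl_satisfiable \<psi>"
  by (simp add: bd_entails_iff_cpl_entails[OF assms reads_as_bd_bot] cpl_entails_def
      cpl_satisfiable_def)

lemmas bd_entails_tr_iff = bd_entails_iff_cpl_entails[OF reads_as_tr reads_as_tr]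

lemmas bd_entails_tr_Conj_tt_iff =
  bd_entails_iff_cpl_entails[OF reads_as_tr reads_as_Conj[OF reads_as_tr reads_as_tt[OF reads_as_tr]]]

lemma quasi_classical_fm_tr: "quasi_classical_fm (tr \<psi>)"
  by (induction \<psi>) (auto intro: quasi_classical_fm.intros)

text \<open>Injectivity gives transitivity: two pairs with a common middle image have a common
  middle preimage, so they compose in \<open>r\<close>.\<close>

lemma total_preorder_on_image:
  assumes "total_preorder_on C r" and inj: "inj f"
  shows "total_preorder_on (f ` C) {(f x, f y) | x y. (x, y) \<in> r}"
proof -
  have "refl_on C r" "trans r" "total_on C r" "r \<subseteq> C \<times> C"
    using assms(1) by (auto simp: total_preorder_on_def preorder_on_def)
  then show ?thesis
    by (force simp: total_preorder_on_def preorder_on_def refl_on_def trans_def total_on_def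
        inj_eq[OF inj])
qed

theorem theorem1:
  fixes \<CC> :: "('p :: countable) cfm cases" and q :: 'p
  assumes "classical_case_model \<CC>"
  shows "quasi_classical_case_model q (bd_counterpart \<CC>) \<and>
    (\<forall>\<phi> \<chi>.
      (classically_coherent \<CC> \<phi> \<chi> \<longleftrightarrow>
        strongly_coherent (bd_counterpart \<CC>) (tr \<phi>) (tr \<chi>)) \<and>
      (classically_presumptively_valid \<CC> \<phi> \<chi> \<longleftrightarrow>
        strongly_presumptively_valid (bd_counterpart \<CC>) (tr \<phi>) (tr \<chi>)) \<and>
      (classically_conclusive \<CC> \<phi> \<chi> \<longleftrightarrow>
        strongly_conclusive (bd_counterpart \<CC>) (tr \<phi>) (tr \<chi>)))"
proof -
  obtain C r where C: "\<CC> = (C, r)" by fastforce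
  have "total_preorder_on (tr ` C) {(tr \<chi>, tr \<chi>') | \<chi> \<chi>'. (\<chi>, \<chi>') \<in> r}"
    using assms by (intro total_preorder_on_image) (auto simp: C inj_def tr_eq_iff)
  then have "quasi_classical_case_model q (bd_counterpart \<CC>)"
    using assms
    by (simp add: C quasi_classical_fm_tr tr_eq_iff bd_entails_bd_bot_iff[OF reads_as_tr]
        bd_entails_bd_bot_iff[OF reads_as_Conj[OF reads_as_tr reads_as_tr]])
  then show ?thesis
    \<comment> \<open>For presumptive validity, \<open>tr_eq_iff\<close> takes the order on
      translations back to \<open>r\<close>.\<close>
    by (simp add: C bd_entails_tr_iff bd_entails_tr_Conj_tt_iff tr_eq_iff)
qed

end
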